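(* Let $\widehat{X}$ be a sandpile graph and let $u,a\in\mathcal{M}(\widehat{X})$ with $u\oplus a=u$. If $a\neq0$, then $a$ cannot access $0$; that is, there is no $k\in\mathcal{M}(\widehat{X})$ with $a\oplus k=0$.
   Context: A sandpile graph $\widehat{X}$ is a finite weakly connected directed multigraph (loops and multiple edges allowed) with a distinguished vertex, the sink, reachable by a directed path from every vertex; the set of non-sink vertices is nonempty. A configuration assigns a nonnegative integer number of grains to each non-sink vertex; it is stable if every $v$ holds fewer than $\deg^{+}(v)$ (out-degree) grains. Toppling an unstable vertex sends one grain along each of its out-edges (grains at the sink vanish; the sink never topples); every configuration has a unique stabilization. $\mathcal{M}(\widehat X)$ is the set of stable configurations with $a\oplus b$ = stabilization of $a+b$, a commutative monoid whose identity $0$ is the empty configuration. *)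

theory Defs
  imports "Graph_Theory.Digraph_Component" "HOL-Algebra.Group"
begin

(* fin_digraph admits loops and parallel arcs; connected is weak connectivity.
   The sink may have outgoing arcs. *)
locale sandpile_graph = fin_digraph X for X :: "('v, 'e) pre_digraph" +
  fixes sink :: 'v
  assumes weakly_connected: "connected X"
    and sink_in_verts: "sink \<in> verts X"
    and sink_reachable: "\<And>v. v \<in> verts X \<Longrightarrow> v \<rightarrow>\<^sup>*\<^bsub>X\<^esub> sink"
    and nonsink_nonempty: "verts X - {sink} \<noteq> {}"

definition nonsink :: "('v, 'e) pre_digraph \<Rightarrow> 'v \<Rightarrow> 'v set" where
  "nonsink X s = verts X - {s}"

(* A configuration is a function on the non-sink vertices; it is extended by 0 to the whole
   vertex type, so that equality of configurations is equality of HOL functions. *)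
definition configurations :: "('v, 'e) pre_digraph \<Rightarrow> 'v \<Rightarrow> ('v \<Rightarrow> nat) set" where
  "configurations X s = {c. \<forall>v. v \<notin> nonsink X s \<longrightarrow> c v = 0}"

definition stable :: "('v, 'e) pre_digraph \<Rightarrow> 'v \<Rightarrow> ('v \<Rightarrow> nat) \<Rightarrow> bool" where
  "stable X s c \<longleftrightarrow> (\<forall>v\<in>nonsink X s. c v < out_degree X v)"

(* The subtraction is only meaningful if v is unstable. A loop at v returns its grain to v. *)
definition topple :: "('v, 'e) pre_digraph \<Rightarrow> 'v \<Rightarrow> 'v \<Rightarrow> ('v \<Rightarrow> nat) \<Rightarrow> 'v \<Rightarrow> nat" where
  "topple X s v c = (\<lambda>w. if w \<in> nonsink X s
     then (c w - (if w = v then out_degree X v else 0)) + card (out_arcs X v \<inter> in_arcs X w)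
     else 0)"

definition topples_to :: "('v, 'e) pre_digraph \<Rightarrow> 'v \<Rightarrow> ('v \<Rightarrow> nat) \<Rightarrow> ('v \<Rightarrow> nat) \<Rightarrow> bool" where
  "topples_to X s c c' \<longleftrightarrow> (\<exists>v\<in>nonsink X s. out_degree X v \<le> c v \<and> c' = topple X s v c)"

definition stabilization :: "('v, 'e) pre_digraph \<Rightarrow> 'v \<Rightarrow> ('v \<Rightarrow> nat) \<Rightarrow> ('v \<Rightarrow> nat)" where
  "stabilization X s c = (THE c'. (topples_to X s)\<^sup>*\<^sup>* c c' \<and> stable X s c')"

definition sandpile_monoid :: "('v, 'e) pre_digraph \<Rightarrow> 'v \<Rightarrow> ('v \<Rightarrow> nat) monoid" where
  "sandpile_monoid X s =
     \<lparr>carrier = {c \<in> configurations X s. stable X s c},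
      mult = (\<lambda>a b. stabilization X s (\<lambda>v. a v + b v)),
      one = (\<lambda>v. 0)\<rparr>"

definition can_access :: "('a, 'm) monoid_scheme \<Rightarrow> 'a \<Rightarrow> 'a \<Rightarrow> bool" where
  "can_access M a b \<longleftrightarrow> (\<exists>k\<in>carrier M. a \<otimes>\<^bsub>M\<^esub> k = b)"

end

theory Submission
  imports Defs
begin

text \<open>
  If \<open>a \<oplus> k = 0\<close>, consider the last toppling of each vertex in the stabilization of \<open>a + k\<close>: a
  non-sink vertex receiving a grain from it must topple again later. Hence the vertices carrying
  grains of \<open>a\<close> lie in a set that is closed under out-neighbours (up to the sink) and induces an
  acyclic graph. All topplings in the stabilization of \<open>u + a\<close> to \<open>u\<close> take place inside this set.
  If there are any, a toppled vertex without toppled in-neighbour receives nothing, so it loses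
  exactly its share of \<open>a\<close>, a positive multiple of its out-degree; this contradicts the stability
  of \<open>a\<close>. If there are none, then \<open>a = 0\<close>.
\<close>

context sandpile_graph
begin

section \<open>Counting arcs between vertices\<close>

abbreviation arc_count :: "'v \<Rightarrow> 'v \<Rightarrow> nat" where
  "arc_count v w \<equiv> card (out_arcs X v \<inter> in_arcs X w)"

lemma finite_nonsink [simp]: "finite (nonsink X sink)"
  by (simp add: nonsink_def)

lemma arc_count_pos_iff: "arc_count v w > 0 \<longleftrightarrow> (\<exists>e\<in>out_arcs X v. head X e = w)"
proof -
  have "finite (out_arcs X v \<inter> in_arcs X w)"
    by (rule finite_subset[of _ "arcs X"]) auto
  then show ?thesis by (auto simp: card_gt_0_iff)
qed

text \<open>Groups the out-arcs by head; the arc-wise form lets a single arc be split off.\<close>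

lemma sum_arc_count:
  fixes h :: "'v \<Rightarrow> nat"
  shows "(\<Sum>w\<in>verts X. arc_count v w * h w) = (\<Sum>e\<in>out_arcs X v. h (head X e))"
proof -
  have "(\<Sum>e\<in>out_arcs X v. h (head X e))
      = (\<Sum>w\<in>verts X. \<Sum>e\<in>{e \<in> out_arcs X v. head X e = w}. h (head X e))"
    by (rule sum.group[symmetric]) auto
  also have "\<dots> = (\<Sum>w\<in>verts X. arc_count v w * h w)"
  proof (rule sum.cong)
    fix w
    have "{e \<in> out_arcs X v. head X e = w} = out_arcs X v \<inter> in_arcs X w" by auto
    moreover have "(\<Sum>e\<in>{e \<in> out_arcs X v. head X e = w}. h (head X e))
        = (\<Sum>e\<in>{e \<in> out_arcs X v. head X e = w}. h w)"
      by (rule sum.cong) auto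
    ultimately show "(\<Sum>e\<in>{e \<in> out_arcs X v. head X e = w}. h (head X e)) = arc_count v w * h w"
      by simp
  qed simp
  finally show ?thesis by simp
qed

section \<open>Termination of toppling\<close>

text \<open>The rank is the distance to the sink, which drops along the first arc of a shortest
  walk.\<close>

lemma exists_descending_rank:
  obtains d :: "'v \<Rightarrow> nat"
  where "\<And>v. v \<in> nonsink X sink \<Longrightarrow> \<exists>e\<in>out_arcs X v. d (head X e) < d v"
proof -
  define d where "d v = (LEAST n. (v, sink) \<in> arcs_ends X ^^ n)" for v
  have "\<exists>e\<in>out_arcs X v. d (head X e) < d v" if v: "v \<in> nonsink X sink" for v
  proof -
    have "v \<rightarrow>\<^sup>*\<^bsub>X\<^esub> sink"
      using v sink_reachable by (simp add: nonsink_def)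
    then have "(v, sink) \<in> (arcs_ends X)\<^sup>*"
      unfolding reachable_def by (rule rtrancl_on_rtranclI)
    then have "\<exists>n. (v, sink) \<in> arcs_ends X ^^ n"
      by (simp add: rtrancl_power)
    then have dv: "(v, sink) \<in> arcs_ends X ^^ d v"
      unfolding d_def by (rule LeastI_ex)
    have "d v \<noteq> 0" using dv v by (auto simp: nonsink_def intro: Nat.gr0I)
    then obtain n where n: "d v = Suc n" by (cases "d v") auto
    then obtain w where w: "(v, w) \<in> arcs_ends X" "(w, sink) \<in> arcs_ends X ^^ n"
      using dv relpow_Suc_D2 by metis
    have "d w \<le> n" unfolding d_def by (rule Least_le) (rule w(2))
    moreover obtain e where "e \<in> out_arcs X v" "head X e = w"
      using w(1) by (auto simp: arcs_ends_def arc_to_ends_def)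
    ultimately show ?thesis using n by (intro bexI[of _ e]) auto
  qed
  then show thesis using that by blast
qed

text \<open>
  With \<open>d\<close> the distance to the sink, the weights \<open>B ^ N - B ^ (N - d v)\<close> work once \<open>B\<close> exceeds
  all out-degrees: the gain at an out-neighbour closer to the sink outweighs all other losses.
\<close>

lemma exists_superharmonic_weight:
  obtains h :: "'v \<Rightarrow> nat"
  where "\<And>v. v \<in> nonsink X sink \<Longrightarrow>
    (\<Sum>w\<in>nonsink X sink. arc_count v w * h w) < out_degree X v * h v"
proof -
  obtain d :: "'v \<Rightarrow> nat"
    where d: "\<And>v. v \<in> nonsink X sink \<Longrightarrow> \<exists>e\<in>out_arcs X v. d (head X e) < d v"
    using exists_descending_rank by blast
  define B where "B = Suc (card (arcs X))"
  \<comment> \<open>An upper bound for the rank of every vertex, so that \<open>N - d v\<close> is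
    never truncated.\<close>
  define N where "N = (\<Sum>v\<in>verts X. d v)"
  define h where "h v = B ^ N - B ^ (N - d v)" for v
  have "(\<Sum>w\<in>nonsink X sink. arc_count v w * h w) < out_degree X v * h v"
    if v: "v \<in> nonsink X sink" for v
  proof -
    obtain e where e: "e \<in> out_arcs X v" "d (head X e) < d v" using d v by blast
    define D where "D = out_degree X v"
    have fin: "finite (out_arcs X v)"
      by (rule finite_subset[of _ "arcs X"]) auto
    have dN: "d v \<le> N"
      unfolding N_def using v by (intro member_le_sum) (auto simp: nonsink_def)
    have out_arcs_sub: "out_arcs X v \<subseteq> arcs X" by auto
    have D: "0 < D" "D < B"
      using e fin card_mono[OF finite_arcs out_arcs_sub]
      by (auto simp: D_def out_degree_def B_def card_gt_0_iff less_Suc_eq_le)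
    have pow: "B ^ k \<le> B ^ N" if "k \<le> N" for k
      using that by (simp add: B_def power_increasing)
    have "B ^ (N - d v + 1) \<le> B ^ (N - d (head X e))"
      using e(2) dN unfolding B_def by (intro power_increasing) auto
    then have he: "h (head X e) + B ^ (N - d v + 1) \<le> B ^ N"
      using pow[of "N - d (head X e)"] unfolding h_def by linarith
    \<comment> \<open>Counting arcs into the sink as well only enlarges the sum.\<close>
    have "(\<Sum>w\<in>nonsink X sink. arc_count v w * h w) \<le> (\<Sum>w\<in>verts X. arc_count v w * h w)"
      by (rule sum_mono2) (auto simp: nonsink_def)
    also have "\<dots> = h (head X e) + (\<Sum>e'\<in>out_arcs X v - {e}. h (head X e'))"
      unfolding sum_arc_count by (rule sum.remove[OF fin e(1)])
    finally have "(\<Sum>w\<in>nonsink X sink. arc_count v w * h w) + B ^ (N - d v + 1)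
        \<le> B ^ N + (\<Sum>e'\<in>out_arcs X v - {e}. h (head X e'))"
      using he by linarith
    \<comment> \<open>Each of the other \<open>D - 1\<close> out-arcs weighs at most
      \<open>B ^ N\<close>.\<close>
    also have "(\<Sum>e'\<in>out_arcs X v - {e}. h (head X e')) \<le> (D - 1) * B ^ N"
      using sum_bounded_above[of "out_arcs X v - {e}" "\<lambda>e. h (head X e)" "B ^ N"] e(1)
      by (simp add: h_def D_def out_degree_def)
    also have "B ^ N + (D - 1) * B ^ N = D * B ^ N"
      using D(1) by (cases D) auto
    finally have 1: "(\<Sum>w\<in>nonsink X sink. arc_count v w * h w) + B ^ (N - d v + 1) \<le> D * B ^ N"
      by simp
    \<comment> \<open>Here \<open>D < B\<close> enters: the saving along \<open>e\<close> exceeds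
      the amount by which \<open>D * h v\<close> falls short of \<open>D * B ^ N\<close>.\<close>
    have 2: "D * B ^ (N - d v) < B ^ (N - d v + 1)"
      using D by simp
    have "D * h v + D * B ^ (N - d v) = D * B ^ N"
      using pow[of "N - d v"] by (simp add: h_def flip: add_mult_distrib2)
    with 1 2 show ?thesis unfolding D_def by linarith
  qed
  then show thesis using that by blast
qed

text \<open>Toppling trades the weight \<open>out_degree X v * h v\<close> for the smaller weight of
  the grains that miss the sink. The total weight is thus a termination measure.\<close>

lemma weight_topple_less:
  fixes h :: "'v \<Rightarrow> nat"
  assumes h: "(\<Sum>w\<in>nonsink X sink. arc_count v w * h w) < out_degree X v * h v"
    and v: "v \<in> nonsink X sink" and unstable: "out_degree X v \<le> c v"
  shows "(\<Sum>w\<in>nonsink X sink. topple X sink v c w * h w) < (\<Sum>w\<in>nonsink X sink. c w * h w)"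
proof -
  \<comment> \<open>The removed weight is added on the left to avoid subtraction on
    naturals.\<close>
  have eq: "topple X sink v c w * h w + (if w = v then out_degree X v * h v else 0)
      = c w * h w + arc_count v w * h w" if "w \<in> nonsink X sink" for w
    using that unstable by (auto simp: topple_def simp flip: add_mult_distrib)
  have "(\<Sum>w\<in>nonsink X sink. topple X sink v c w * h w) + out_degree X v * h v
      = (\<Sum>w\<in>nonsink X sink. topple X sink v c w * h w
          + (if w = v then out_degree X v * h v else 0))"
    using v by (simp add: sum.distrib)
  also have "\<dots> = (\<Sum>w\<in>nonsink X sink. c w * h w + arc_count v w * h w)"
    by (rule sum.cong) (auto simp: eq)
  finally show ?thesis using h by (simp add: sum.distrib)
qed

lemma wfP_topples_to: "wfP (\<lambda>c' c. topples_to X sink c c')"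
proof -
  obtain h :: "'v \<Rightarrow> nat" where h: "\<And>v. v \<in> nonsink X sink \<Longrightarrow>
      (\<Sum>w\<in>nonsink X sink. arc_count v w * h w) < out_degree X v * h v"
    using exists_superharmonic_weight by blast
  show ?thesis
  proof (rule wfp_if_convertible_to_nat)
    fix c' c
    assume "topples_to X sink c c'"
    then show "(\<Sum>w\<in>nonsink X sink. c' w * h w) < (\<Sum>w\<in>nonsink X sink. c w * h w)"
      using h weight_topple_less by (auto simp: topples_to_def)
  qed
qed

lemma exists_stabilization: "\<exists>c'. (topples_to X sink)\<^sup>*\<^sup>* c c' \<and> stable X sink c'"
proof (induction c rule: wfp_induct_rule[OF wfP_topples_to])
  case (1 c)
  show ?case
  proof (cases "stable X sink c")
    case False
    then obtain c1 where "topples_to X sink c c1"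
      by (auto simp: stable_def topples_to_def not_less)
    with 1 show ?thesis by (meson converse_rtranclp_into_rtranclp)
  qed blast
qed

section \<open>Uniqueness of the stabilization\<close>

text \<open>Toppling one vertex never takes grains from another, so both topplings stay legal, and
  they commute.\<close>

lemma topples_to_diamond:
  assumes "topples_to X sink c c1" "topples_to X sink c c2" "c1 \<noteq> c2"
  shows "\<exists>c3. topples_to X sink c1 c3 \<and> topples_to X sink c2 c3"
proof -
  obtain v where v: "v \<in> nonsink X sink" "out_degree X v \<le> c v" "c1 = topple X sink v c"
    using assms(1) by (auto simp: topples_to_def)
  obtain w where w: "w \<in> nonsink X sink" "out_degree X w \<le> c w" "c2 = topple X sink w c"
    using assms(2) by (auto simp: topples_to_def)
  have "v \<noteq> w" using assms(3) v(3) w(3) by auto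
  then have "out_degree X w \<le> c1 w" "out_degree X v \<le> c2 v"
    using v w by (auto simp: topple_def)
  moreover have "topple X sink w c1 = topple X sink v c2"
    unfolding v(3) w(3) using \<open>v \<noteq> w\<close> v(1,2) w(1,2) by (auto simp: topple_def fun_eq_iff)
  ultimately show ?thesis using v(1) w(1) by (auto simp: topples_to_def)
qed

lemma not_topples_to_if_stable: "stable X sink c \<Longrightarrow> \<not> topples_to X sink c c'"
  by (auto simp: stable_def topples_to_def not_le)

text \<open>Newman's argument: two different first topplings are joined in \<open>c3\<close>, and a
  stable \<open>d3\<close> below \<open>c3\<close> equals both results by induction.\<close>

lemma stabilization_unique:
  assumes "(topples_to X sink)\<^sup>*\<^sup>* c d1" "stable X sink d1"
    and "(topples_to X sink)\<^sup>*\<^sup>* c d2" "stable X sink d2"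
  shows "d1 = d2"
  using assms
proof (induction c arbitrary: d1 d2 rule: wfp_induct_rule[OF wfP_topples_to])
  case (1 c)
  show ?case
  proof (cases "stable X sink c")
    case True
    then have "c = d1" "c = d2"
      using 1(2,4) not_topples_to_if_stable[of c] by (auto elim: converse_rtranclpE)
    then show ?thesis by simp
  next
    case False
    obtain c1 where c1: "topples_to X sink c c1" "(topples_to X sink)\<^sup>*\<^sup>* c1 d1"
      using 1(2,3) False by (cases rule: converse_rtranclpE) auto
    obtain c2 where c2: "topples_to X sink c c2" "(topples_to X sink)\<^sup>*\<^sup>* c2 d2"
      using 1(4,5) False by (cases rule: converse_rtranclpE) auto
    show ?thesis
    proof (cases "c1 = c2")
      case True
      then show ?thesis using 1(1)[OF c1 1(3)] c2(2) 1(5) by blast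
    next
      case False
      then obtain c3 where c3: "topples_to X sink c1 c3" "topples_to X sink c2 c3"
        using topples_to_diamond c1(1) c2(1) by blast
      obtain d3 where d3: "(topples_to X sink)\<^sup>*\<^sup>* c3 d3" "stable X sink d3"
        using exists_stabilization by blast
      have "d1 = d3"
        using 1(1)[OF c1 1(3) converse_rtranclp_into_rtranclp[OF c3(1) d3(1)] d3(2)] .
      moreover have "d2 = d3"
        using 1(1)[OF c2 1(5) converse_rtranclp_into_rtranclp[OF c3(2) d3(1)] d3(2)] .
      ultimately show ?thesis by simp
    qed
  qed
qed

lemma topples_to_stabilization: "(topples_to X sink)\<^sup>*\<^sup>* c (stabilization X sink c)"
proof -
  have "\<exists>!c'. (topples_to X sink)\<^sup>*\<^sup>* c c' \<and> stable X sink c'"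
    using exists_stabilization stabilization_unique by blast
  from theI'[OF this] show ?thesis by (simp add: stabilization_def)
qed

section \<open>Draining vertices and the odometer\<close>

text \<open>A vertex drains if no directed walk from it avoiding the sink is infinite.\<close>

inductive drains :: "'v \<Rightarrow> bool" where
  "(\<And>e. e \<in> out_arcs X v \<Longrightarrow> head X e \<noteq> sink \<Longrightarrow> drains (head X e)) \<Longrightarrow> drains v"

text \<open>Backward induction from the empty configuration. If \<open>w\<close> topples first,
  every non-sink out-neighbour then holds a grain, hence drains (for a loop this is \<open>w\<close>
  itself); otherwise \<open>w\<close> keeps its grains.\<close>

lemma drains_if_topples_to_zero:
  assumes "(topples_to X sink)\<^sup>*\<^sup>* c (\<lambda>_. 0)" "w \<in> nonsink X sink" "c w > 0"
  shows "drains w"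
  using assms
proof (induction arbitrary: w rule: converse_rtranclp_induct)
  case (step c c1)
  obtain v where v: "v \<in> nonsink X sink" "c1 = topple X sink v c"
    using step.hyps(1) by (auto simp: topples_to_def)
  show ?case
  proof (cases "w = v")
    case True
    show ?thesis
    proof (rule drains.intros)
      fix e
      assume e: "e \<in> out_arcs X w" "head X e \<noteq> sink"
      then have "head X e \<in> nonsink X sink" by (auto simp: nonsink_def)
      moreover from this have "c1 (head X e) > 0"
        using e(1) True arc_count_pos_iff[of v "head X e"] unfolding v(2) topple_def by auto
      ultimately show "drains (head X e)" by (rule step.IH)
    qed
  next
    case False
    then have "c1 w > 0" using step.prems v by (simp add: topple_def)
    with step show ?thesis by blast
  qed
qed simp

text \<open>The function \<open>x\<close> is the odometer: it counts how often each vertex topples.\<close>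

lemma exists_draining_odometer:
  assumes stable: "stable X sink u"
    and a: "\<And>w. w \<in> nonsink X sink \<Longrightarrow> a w > 0 \<Longrightarrow> drains w"
    and path: "(topples_to X sink)\<^sup>*\<^sup>* (\<lambda>w. u w + a w) c"
  shows "\<exists>x :: 'v \<Rightarrow> nat. (\<forall>v. x v > 0 \<longrightarrow> v \<in> nonsink X sink \<and> drains v) \<and>
    (\<forall>w\<in>nonsink X sink. u w + a w + (\<Sum>v\<in>nonsink X sink. x v * arc_count v w)
      = c w + x w * out_degree X w)"
  using path
proof induction
  case base
  show ?case by (rule exI[of _ "\<lambda>_. 0"]) simp
next
  case (step c c1)
  then obtain x :: "'v \<Rightarrow> nat"
    where x: "\<And>v. x v > 0 \<Longrightarrow> v \<in> nonsink X sink \<and> drains v"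
      and bal: "\<And>w. w \<in> nonsink X sink \<Longrightarrow>
        u w + a w + (\<Sum>v\<in>nonsink X sink. x v * arc_count v w) = c w + x w * out_degree X w"
    by blast
  obtain v where v: "v \<in> nonsink X sink" "out_degree X v \<le> c v" "c1 = topple X sink v c"
    using step.hyps(2) by (auto simp: topples_to_def)
  \<comment> \<open>A vertex that does not drain has no grains of \<open>a\<close>, has not toppled,
    and receives nothing from draining vertices. It would still hold \<open>u v\<close> grains, too
    few to topple.\<close>
  have "drains v"
  proof (rule ccontr)
    assume v_undrained: "\<not> drains v"
    have "(\<Sum>v'\<in>nonsink X sink. x v' * arc_count v' v) = 0"
    proof (intro sum.neutral ballI, rule ccontr)
      fix v'
      assume "x v' * arc_count v' v \<noteq> 0"
      then have "x v' > 0" "arc_count v' v > 0" by auto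
      then obtain e where "e \<in> out_arcs X v'" "head X e = v"
        using arc_count_pos_iff by blast
      moreover have "drains v'" using x \<open>x v' > 0\<close> by blast
      ultimately show False
        using v(1) v_undrained by (auto simp: nonsink_def elim: drains.cases)
    qed
    moreover have "a v = 0" "x v * out_degree X v = 0"
      using v_undrained a v(1) x by auto
    ultimately have "c v = u v" using bal[OF v(1)] by linarith
    then show False using v(1,2) stable by (auto simp: stable_def)
  qed
  have "u w + a w + (\<Sum>v'\<in>nonsink X sink. (x(v := Suc (x v))) v' * arc_count v' w)
      = c1 w + (x(v := Suc (x v))) w * out_degree X w" if w: "w \<in> nonsink X sink" for w
  proof -
    have "(\<Sum>v'\<in>nonsink X sink. (x(v := Suc (x v))) v' * arc_count v' w)
        = (\<Sum>v'\<in>nonsink X sink. x v' * arc_count v' w + (if v' = v then arc_count v w else 0))"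
      by (rule sum.cong) auto
    also have "\<dots> = (\<Sum>v'\<in>nonsink X sink. x v' * arc_count v' w) + arc_count v w"
      using v(1) by (simp add: sum.distrib)
    finally show ?thesis using bal[OF w] v w by (auto simp: topple_def)
  qed
  moreover have "\<forall>v'. (x(v := Suc (x v))) v' > 0 \<longrightarrow> v' \<in> nonsink X sink \<and> drains v'"
    using x v(1) \<open>drains v\<close> by auto
  ultimately show ?case by blast
qed

text \<open>Forward walks inside \<open>S\<close> end because its vertices drain; as
  \<open>S\<close> is finite, backward walks end as well.\<close>

lemma exists_source_of_draining_set:
  assumes S: "S \<subseteq> nonsink X sink" "S \<noteq> {}" and dr: "\<And>v. v \<in> S \<Longrightarrow> drains v"
  obtains v where "v \<in> S" "\<And>v'. v' \<in> S \<Longrightarrow> arc_count v' v = 0"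
proof -
  \<comment> \<open>Heads come first in the pairs, so that accessibility in \<open>E\<close> follows
    the induction for \<open>drains\<close>.\<close>
  define E where "E = {(w, v). v \<in> S \<and> w \<in> S \<and> arc_count v w > 0}"
  have "v \<in> Wellfounded.acc E" if "drains v" for v
    using that
  proof induction
    case (1 v)
    show ?case
    proof (rule accI)
      fix w
      assume "(w, v) \<in> E"
      then have "arc_count v w > 0" "w \<noteq> sink"
        using S(1) by (auto simp: E_def nonsink_def)
      then obtain e where "e \<in> out_arcs X v" "head X e = w"
        using arc_count_pos_iff by blast
      then show "w \<in> Wellfounded.acc E"
        using 1(2)[of e] \<open>w \<noteq> sink\<close> by simp
    qed
  qed
  \<comment> \<open>Outside \<open>S\<close> accessibility is trivial, as \<open>E\<close> has no
    pairs there.\<close>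
  then have "v \<in> Wellfounded.acc E" for v
    using dr by (cases "v \<in> S") (auto simp: E_def intro: accI)
  then have "wf E" by (simp add: acc_wfI)
  moreover have "finite E"
    by (rule finite_subset[of _ "nonsink X sink \<times> nonsink X sink"]) (use S(1) in \<open>auto simp: E_def\<close>)
  ultimately have "wf (E\<inverse>)"
    by (simp add: finite_acyclic_wf_converse wf_acyclic)
  then obtain v where v: "v \<in> S" "\<And>v'. (v', v) \<in> E\<inverse> \<Longrightarrow> v' \<notin> S"
    using S(2) wf_eq_minimal by (metis ex_in_conv)
  show thesis
  proof (rule that[OF v(1)])
    fix v'
    assume "v' \<in> S"
    then have "(v, v') \<notin> E" using v(2)[of v'] by blast
    then show "arc_count v' v = 0"
      using v(1) \<open>v' \<in> S\<close> unfolding E_def by simp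
  qed
qed

section \<open>Absorbed configurations with draining support\<close>

lemma zero_if_draining_and_absorbed:
  assumes u: "stable X sink u" and a: "stable X sink a" "a \<in> configurations X sink"
    and dr: "\<And>w. w \<in> nonsink X sink \<Longrightarrow> a w > 0 \<Longrightarrow> drains w"
    and path: "(topples_to X sink)\<^sup>*\<^sup>* (\<lambda>w. u w + a w) u"
  shows "a = (\<lambda>_. 0)"
proof -
  obtain x :: "'v \<Rightarrow> nat"
    where x: "\<And>v. x v > 0 \<Longrightarrow> v \<in> nonsink X sink \<and> drains v"
      and bal: "\<And>w. w \<in> nonsink X sink \<Longrightarrow>
        u w + a w + (\<Sum>v\<in>nonsink X sink. x v * arc_count v w) = u w + x w * out_degree X w"
    using exists_draining_odometer[OF u dr path] by blast
  have "{v. x v > 0} = {}"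
  proof (rule ccontr)
    assume "{v. x v > 0} \<noteq> {}"
    moreover have "{v. x v > 0} \<subseteq> nonsink X sink" "\<And>v. v \<in> {v. x v > 0} \<Longrightarrow> drains v"
      using x by auto
    ultimately obtain v where v: "x v > 0" "\<And>v'. x v' > 0 \<Longrightarrow> arc_count v' v = 0"
      by (metis exists_source_of_draining_set mem_Collect_eq)
    have "(\<Sum>v'\<in>nonsink X sink. x v' * arc_count v' v) = 0"
    proof (intro sum.neutral ballI)
      fix v'
      show "x v' * arc_count v' v = 0" using v(2)[of v'] by (cases "x v' = 0") simp_all
    qed
    \<comment> \<open>No toppled vertex, \<open>v\<close> included, sends a grain to
      \<open>v\<close>, so the balance has no incoming term.\<close>
    then have "a v = x v * out_degree X v"
      using bal[of v] x[OF v(1)] by linarith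
    then have "out_degree X v \<le> a v" using v(1) by simp
    then show False using a(1) x[OF v(1)] by (auto simp: stable_def)
  qed
  then have x0: "x v = 0" for v by auto
  show ?thesis
  proof
    fix w
    show "a w = 0"
      using bal[of w] a(2) by (cases "w \<in> nonsink X sink") (auto simp: x0 configurations_def)
  qed
qed

end

theorem theorem5p2:
  fixes X :: "('v, 'e) pre_digraph" and sink :: 'v and u a :: "'v \<Rightarrow> nat"
  assumes "sandpile_graph X sink"
    and "u \<in> carrier (sandpile_monoid X sink)"
    and "a \<in> carrier (sandpile_monoid X sink)"
    and "u \<otimes>\<^bsub>sandpile_monoid X sink\<^esub> a = u"
    and "a \<noteq> \<one>\<^bsub>sandpile_monoid X sink\<^esub>"
  shows "\<not> can_access (sandpile_monoid X sink) a \<one>\<^bsub>sandpile_monoid X sink\<^esub>"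
proof
  interpret sandpile_graph X sink by fact
  assume "can_access (sandpile_monoid X sink) a \<one>\<^bsub>sandpile_monoid X sink\<^esub>"
  then obtain k where "stabilization X sink (\<lambda>v. a v + k v) = (\<lambda>_. 0)"
    by (auto simp: can_access_def sandpile_monoid_def)
  then have path: "(topples_to X sink)\<^sup>*\<^sup>* (\<lambda>v. a v + k v) (\<lambda>_. 0)"
    using topples_to_stabilization[of "\<lambda>v. a v + k v"] by simp
  \<comment> \<open>A grain of \<open>a\<close> at \<open>w\<close> is also one of
    \<open>a + k\<close>, which topples down to nothing.\<close>
  have "drains w" if "w \<in> nonsink X sink" "a w > 0" for w
    using drains_if_topples_to_zero[OF path] that by simp
  moreover have "(topples_to X sink)\<^sup>*\<^sup>* (\<lambda>v. u v + a v) u"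
    using topples_to_stabilization[of "\<lambda>v. u v + a v"] assms(4) by (simp add: sandpile_monoid_def)
  ultimately have "a = (\<lambda>_. 0)"
    using assms(2,3) by (intro zero_if_draining_and_absorbed[of u]) (auto simp: sandpile_monoid_def)
  with assms(5) show False by (simp add: sandpile_monoid_def)
qed

end
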